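(* Let $X$ and $Y$ be topological spaces and let $\varphi : X \to Y$ be a set function (not assumed continuous). Let $T_\varphi : \mathrm{Closed}(X) \to \mathrm{Closed}(Y)$ be the functor $U \mapsto \overline{\varphi(U)}$ and let $T^\varphi : \mathrm{Closed}(Y) \to \mathrm{Closed}(X)$ be the functor $V \mapsto \overline{\varphi^{-1}(V)}$. Then $\varphi$ is continuous if and only if $(T_\varphi, T^\varphi)$ is an adjoint pair.
   Context: For a topological space $X$, $\mathrm{Closed}(X)$ denotes the category whose objects are the closed subsets of $X$, and in which, for closed subsets $U, U'$ of $X$, there is exactly one morphism $U \to U'$ (the inclusion map) if $U \subseteq U'$, and no morphism $U \to U'$ otherwise. $\mathrm{Closed}(Y)$ is defined in the same way. $\overline{S}$ denotes the topological closure of a subset $S$ of $X$ (taken in $X$) or of $Y$ (taken in $Y$). The assignments $T_\varphi$ and $T^\varphi$ preserve inclusions, and so are (covariant) functors, with the action on morphisms being the evident one (inclusions go to inclusions). Given categories $\mathcal{C}$, $\mathcal{D}$ and functors $\Phi : \mathcal{C} \to \mathcal{D}$, $\Psi : \mathcal{D} \to \mathcal{C}$, the pair $(\Phi, \Psi)$ is called an adjoint pair (with $\Phi$ the left adjoint and $\Psi$ the right adjoint) if for all objects $L$ of $\mathcal{C}$ and $M$ of $\mathcal{D}$ there is a bijection $\beta : \mathrm{Hom}_{\mathcal{D}}(\Phi(L), M) \to \mathrm{Hom}_{\mathcal{C}}(L, \Psi(M))$ that is natural in $L$ and $M$, meaning that $\beta(t \circ r) = \Psi(t) \circ \beta(r)$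 and $\beta(r \circ \Phi(s)) = \beta(r) \circ s$ for all $\mathcal{D}$-morphisms $r : \Phi(L) \to M$, all $\mathcal{C}$-morphisms $s : L' \to L$ and all $\mathcal{D}$-morphisms $t : M \to M'$. *)

theory Defs
  imports "HOL-Analysis.Analysis"
begin

section \<open>Categories, functors and adjoint pairs\<close>

record ('o, 'm) cat =
  Obj :: "'o set"
  Hom :: "'o \<Rightarrow> 'o \<Rightarrow> 'm set"
  Id :: "'o \<Rightarrow> 'm"
  Comp :: "'m \<Rightarrow> 'm \<Rightarrow> 'm"  \<comment> \<open>\<open>Comp C g f\<close> is \<open>g\<close> after \<open>f\<close>\<close>

locale category =
  fixes C :: "('o, 'm) cat"
  assumes Id_in_Hom: "a \<in> Obj C \<Longrightarrow> Id C a \<in> Hom C a a"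
    and Comp_in_Hom: "\<lbrakk>a \<in> Obj C; b \<in> Obj C; c \<in> Obj C; f \<in> Hom C a b; g \<in> Hom C b c\<rbrakk>
      \<Longrightarrow> Comp C g f \<in> Hom C a c"
    and Comp_Id: "\<lbrakk>a \<in> Obj C; b \<in> Obj C; f \<in> Hom C a b\<rbrakk> \<Longrightarrow> Comp C f (Id C a) = f"
    and Id_Comp: "\<lbrakk>a \<in> Obj C; b \<in> Obj C; f \<in> Hom C a b\<rbrakk> \<Longrightarrow> Comp C (Id C b) f = f"
    and Comp_assoc: "\<lbrakk>a \<in> Obj C; b \<in> Obj C; c \<in> Obj C; d \<in> Obj C;
        f \<in> Hom C a b; g \<in> Hom C b c; h \<in> Hom C c d\<rbrakk>
      \<Longrightarrow> Comp C h (Comp C g f) = Comp C (Comp C h g) f"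
    and Hom_disjoint: "\<lbrakk>a \<in> Obj C; b \<in> Obj C; a' \<in> Obj C; b' \<in> Obj C;
        f \<in> Hom C a b; f \<in> Hom C a' b'\<rbrakk> \<Longrightarrow> a = a' \<and> b = b'"

record ('o, 'm, 'p, 'n) ftor =
  on_obj :: "'o \<Rightarrow> 'p"
  on_hom :: "'m \<Rightarrow> 'n"

locale cat_functor = C: category C + D: category D
  for C :: "('o, 'm) cat" and D :: "('p, 'n) cat" +
  fixes F :: "('o, 'm, 'p, 'n) ftor"
  assumes on_obj_in_Obj: "a \<in> Obj C \<Longrightarrow> on_obj F a \<in> Obj D"
    and on_hom_in_Hom: "\<lbrakk>a \<in> Obj C; b \<in> Obj C; f \<in> Hom C a b\<rbrakk>
      \<Longrightarrow> on_hom F f \<in> Hom D (on_obj F a) (on_obj F b)"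
    and on_hom_Id: "a \<in> Obj C \<Longrightarrow> on_hom F (Id C a) = Id D (on_obj F a)"
    and on_hom_Comp: "\<lbrakk>a \<in> Obj C; b \<in> Obj C; c \<in> Obj C; f \<in> Hom C a b; g \<in> Hom C b c\<rbrakk>
      \<Longrightarrow> on_hom F (Comp C g f) = Comp D (on_hom F g) (on_hom F f)"

definition adjoint_pair ::
  "('o, 'm) cat \<Rightarrow> ('p, 'n) cat \<Rightarrow> ('o, 'm, 'p, 'n) ftor \<Rightarrow> ('p, 'n, 'o, 'm) ftor \<Rightarrow> bool"
where
  "adjoint_pair C D \<Phi> \<Psi> \<longleftrightarrow>
    cat_functor C D \<Phi> \<and> cat_functor D C \<Psi> \<and>
    (\<exists>\<beta> :: 'o \<Rightarrow> 'p \<Rightarrow> 'n \<Rightarrow> 'm.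
      (\<forall>L\<in>Obj C. \<forall>M\<in>Obj D.
        bij_betw (\<beta> L M) (Hom D (on_obj \<Phi> L) M) (Hom C L (on_obj \<Psi> M))) \<and>
      (\<forall>L\<in>Obj C. \<forall>M\<in>Obj D. \<forall>M'\<in>Obj D. \<forall>r\<in>Hom D (on_obj \<Phi> L) M. \<forall>t\<in>Hom D M M'.
        \<beta> L M' (Comp D t r) = Comp C (on_hom \<Psi> t) (\<beta> L M r)) \<and>
      (\<forall>L\<in>Obj C. \<forall>L'\<in>Obj C. \<forall>M\<in>Obj D. \<forall>r\<in>Hom D (on_obj \<Phi> L) M. \<forall>s\<in>Hom C L' L.
        \<beta> L' M (Comp D r (on_hom \<Phi> s)) = Comp C (\<beta> L M r) s))"

section \<open>The category of closed subsets\<close>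

text \<open>A map between subsets is a triple of its domain, an underlying function that is
  \<^const>\<open>undefined\<close> outside the domain, and its codomain.\<close>

type_synonym 'a set_map = "'a set \<times> ('a \<Rightarrow> 'a) \<times> 'a set"

definition map_dom :: "'a set_map \<Rightarrow> 'a set" where
  "map_dom f = fst f"

definition map_fun :: "'a set_map \<Rightarrow> 'a \<Rightarrow> 'a" where
  "map_fun f = fst (snd f)"

definition map_cod :: "'a set_map \<Rightarrow> 'a set" where
  "map_cod f = snd (snd f)"

definition inclusion :: "'a set \<Rightarrow> 'a set \<Rightarrow> 'a set_map" where
  "inclusion U U' = (U, (\<lambda>x\<in>U. x), U')"

definition Closed :: "'a topology \<Rightarrow> ('a set, 'a set_map) cat" where
  "Closed X =
    \<lparr>Obj = {U. closedin X U},
     Hom = (\<lambda>U U'. if U \<subseteq> U' then {inclusion U U'} else {}),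
     Id = (\<lambda>U. inclusion U U),
     Comp = (\<lambda>g f. (map_dom f, compose (map_dom f) (map_fun g) (map_fun f), map_cod g))\<rparr>"

text \<open>\<open>T_image Y \<phi>\<close> is $T_\varphi$ and \<open>T_preimage X \<phi>\<close> is $T^\varphi$.\<close>

definition image_closure :: "'b topology \<Rightarrow> ('a \<Rightarrow> 'b) \<Rightarrow> 'a set \<Rightarrow> 'b set" where
  "image_closure Y \<phi> U = Y closure_of (\<phi> ` U)"

definition preimage_closure :: "'a topology \<Rightarrow> ('a \<Rightarrow> 'b) \<Rightarrow> 'b set \<Rightarrow> 'a set" where
  "preimage_closure X \<phi> V = X closure_of {x \<in> topspace X. \<phi> x \<in> V}"

definition T_image ::
  "'b topology \<Rightarrow> ('a \<Rightarrow> 'b) \<Rightarrow> ('a set, 'a set_map, 'b set, 'b set_map) ftor"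
where
  "T_image Y \<phi> =
    \<lparr>on_obj = image_closure Y \<phi>,
     on_hom = (\<lambda>i. inclusion (image_closure Y \<phi> (map_dom i)) (image_closure Y \<phi> (map_cod i)))\<rparr>"

definition T_preimage ::
  "'a topology \<Rightarrow> ('a \<Rightarrow> 'b) \<Rightarrow> ('b set, 'b set_map, 'a set, 'a set_map) ftor"
where
  "T_preimage X \<phi> =
    \<lparr>on_obj = preimage_closure X \<phi>,
     on_hom = (\<lambda>i. inclusion (preimage_closure X \<phi> (map_dom i)) (preimage_closure X \<phi> (map_cod i)))\<rparr>"

lemmas Closed_simps = Closed_def inclusion_def map_dom_def map_fun_def map_cod_def

lemma category_Closed: "category (Closed X)"
  by unfold_locales (auto simp: Closed_simps compose_def fun_eq_iff split: if_splits)

lemma image_closure_mono: "U \<subseteq> U' \<Longrightarrow> image_closure Y \<phi> U \<subseteq> image_closure Y \<phi> U'"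
  by (simp add: image_closure_def closure_of_mono image_mono)

lemma preimage_closure_mono: "V \<subseteq> V' \<Longrightarrow> preimage_closure X \<phi> V \<subseteq> preimage_closure X \<phi> V'"
  unfolding preimage_closure_def by (rule closure_of_mono) auto

lemma cat_functor_T_image: "cat_functor (Closed X) (Closed Y) (T_image Y \<phi>)"
proof -
  interpret X: category "Closed X" by (rule category_Closed)
  interpret Y: category "Closed Y" by (rule category_Closed)
  have cl: "closedin Y (image_closure Y \<phi> U)" for U
    by (simp add: image_closure_def)
  show ?thesis
    using image_closure_mono[of _ _ Y \<phi>] cl
    by unfold_locales
      (auto simp: T_image_def Closed_simps compose_def fun_eq_iff split: if_splits)
qed

lemma cat_functor_T_preimage: "cat_functor (Closed Y) (Closed X) (T_preimage X \<phi>)"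
proof -
  interpret X: category "Closed X" by (rule category_Closed)
  interpret Y: category "Closed Y" by (rule category_Closed)
  have cl: "closedin X (preimage_closure X \<phi> V)" for V
    by (simp add: preimage_closure_def)
  show ?thesis
    using preimage_closure_mono[of _ _ X \<phi>] cl
    by unfold_locales
      (auto simp: T_preimage_def Closed_simps compose_def fun_eq_iff split: if_splits)
qed

end

theory Submission
  imports Defs
begin

text \<open>
  The categories of closed sets are posets, so an adjunction between them is a Galois
  connection: \<open>(T_image Y \<phi>, T_preimage X \<phi>)\<close> is an adjoint pair iff, for all closed \<open>U\<close> and \<open>V\<close>,
  the closure of the image of \<open>U\<close> lies in \<open>V\<close> exactly when \<open>U\<close> lies in the closure of the
  preimage of \<open>V\<close> (lemma \<open>adjoint_pair_iff_galois\<close>).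

  Since \<open>V\<close> is closed, the first condition says that \<open>U\<close> lies in the preimage of \<open>V\<close> itself. So the
  Galois condition demands that the preimage of \<open>V\<close> and its closure contain the same closed sets.
  If \<open>\<phi>\<close> is continuous this is clear, because the preimage is its own closure. Conversely, taking
  for \<open>U\<close> the closure of the preimage shows that this closure is contained in the preimage,
  which is therefore closed.
\<close>

lemma Obj_Closed: "U \<in> Obj (Closed X) \<longleftrightarrow> closedin X U"
  by (simp add: Closed_def)

lemma Hom_Closed: "Hom (Closed X) U U' = (if U \<subseteq> U' then {inclusion U U'} else {})"
  by (simp add: Closed_def)

lemma Comp_inclusion:
  assumes "U \<subseteq> U'"
  shows "Comp (Closed X) (inclusion U' U'') (inclusion U U') = inclusion U U''"
  using assms by (auto simp: Closed_simps compose_def fun_eq_iff)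

lemma on_obj_T_image: "on_obj (T_image Y \<phi>) = image_closure Y \<phi>"
  by (simp add: T_image_def)

lemma on_obj_T_preimage: "on_obj (T_preimage X \<phi>) = preimage_closure X \<phi>"
  by (simp add: T_preimage_def)

lemma on_hom_T_preimage:
  "on_hom (T_preimage X \<phi>) (inclusion V V') =
    inclusion (preimage_closure X \<phi> V) (preimage_closure X \<phi> V')"
  by (simp add: T_preimage_def inclusion_def map_dom_def map_cod_def)

text \<open>
  Every hom-set has at most one element, so a bijection between two of them exists iff both are
  empty or both are not, and naturality holds because parallel morphisms agree.
\<close>

lemma adjoint_pair_iff_galois:
  "adjoint_pair (Closed X) (Closed Y) (T_image Y \<phi>) (T_preimage X \<phi>) \<longleftrightarrow>
    (\<forall>U V. closedin X U \<longrightarrow> closedin Y V \<longrightarrow>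
      (image_closure Y \<phi> U \<subseteq> V \<longleftrightarrow> U \<subseteq> preimage_closure X \<phi> V))"
  (is "?adj \<longleftrightarrow> ?galois")
proof
  assume ?adj
  then obtain \<beta> where \<beta>: "\<forall>U\<in>Obj (Closed X). \<forall>V\<in>Obj (Closed Y).
      bij_betw (\<beta> U V) (Hom (Closed Y) (image_closure Y \<phi> U) V)
        (Hom (Closed X) U (preimage_closure X \<phi> V))"
    unfolding adjoint_pair_def on_obj_T_image on_obj_T_preimage
    by (elim conjE exE) (rule that)
  show ?galois
  proof (intro allI impI)
    fix U V assume "closedin X U" "closedin Y V"
    then have "bij_betw (\<beta> U V) (Hom (Closed Y) (image_closure Y \<phi> U) V)
        (Hom (Closed X) U (preimage_closure X \<phi> V))"
      using \<beta> by (simp add: Obj_Closed)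
    from bij_betw_imp_surj_on[OF this]
    show "image_closure Y \<phi> U \<subseteq> V \<longleftrightarrow> U \<subseteq> preimage_closure X \<phi> V"
      by (auto simp: Hom_Closed split: if_splits)
  qed
next
  assume galois: ?galois
  define \<beta> :: "'a set \<Rightarrow> 'b set \<Rightarrow> 'b set_map \<Rightarrow> 'a set_map"
    where "\<beta> = (\<lambda>U V _. inclusion U (preimage_closure X \<phi> V))"
  have bij: "bij_betw (\<beta> U V) (Hom (Closed Y) (image_closure Y \<phi> U) V)
      (Hom (Closed X) U (preimage_closure X \<phi> V))"
    if "closedin X U" "closedin Y V" for U V
  proof -
    have "image_closure Y \<phi> U \<subseteq> V \<longleftrightarrow> U \<subseteq> preimage_closure X \<phi> V"
      using galois that by blast
    then show ?thesis
      by (simp add: \<beta>_def Hom_Closed bij_betw_def)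
  qed
  have nat_cod: "\<beta> U V' (Comp (Closed Y) t r) = Comp (Closed X) (on_hom (T_preimage X \<phi>) t) (\<beta> U V r)"
    if "closedin X U" "closedin Y V" "r \<in> Hom (Closed Y) (image_closure Y \<phi> U) V"
      "t \<in> Hom (Closed Y) V V'" for U V V' r t
  proof -
    have "image_closure Y \<phi> U \<subseteq> V" "V \<subseteq> V'" "t = inclusion V V'"
      using that(3,4) by (simp_all add: Hom_Closed split: if_splits)
    moreover have "U \<subseteq> preimage_closure X \<phi> V"
      using galois that(1,2) \<open>image_closure Y \<phi> U \<subseteq> V\<close> by blast
    ultimately show ?thesis
      by (simp add: \<beta>_def on_hom_T_preimage Comp_inclusion)
  qed
  have nat_dom: "\<beta> U' V (Comp (Closed Y) r (on_hom (T_image Y \<phi>) s)) = Comp (Closed X) (\<beta> U V r) s"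
    if "s \<in> Hom (Closed X) U' U" for U U' V r s
  proof -
    have "U' \<subseteq> U" "s = inclusion U' U"
      using that by (simp_all add: Hom_Closed split: if_splits)
    then show ?thesis
      by (simp add: \<beta>_def Comp_inclusion)
  qed
  show ?adj
    unfolding adjoint_pair_def on_obj_T_image on_obj_T_preimage
    by (intro conjI exI[of _ \<beta>] ballI)
      (simp_all only: Obj_Closed cat_functor_T_image cat_functor_T_preimage bij nat_cod nat_dom)
qed

lemma image_closure_subset_iff:
  assumes "\<phi> \<in> topspace X \<rightarrow> topspace Y" "closedin X U" "closedin Y V"
  shows "image_closure Y \<phi> U \<subseteq> V \<longleftrightarrow> U \<subseteq> {x \<in> topspace X. \<phi> x \<in> V}"
proof -
  have U: "U \<subseteq> topspace X"
    using assms(2) by (rule closedin_subset)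
  then have "\<phi> ` U \<subseteq> topspace Y"
    using assms(1) by auto
  then have "image_closure Y \<phi> U \<subseteq> V \<longleftrightarrow> \<phi> ` U \<subseteq> V"
    unfolding image_closure_def
    using closure_of_minimal[OF _ assms(3)] closure_of_subset by blast
  then show ?thesis
    using U by auto
qed

theorem mainTheorem1:
  fixes X :: "'a topology" and Y :: "'b topology" and \<phi> :: "'a \<Rightarrow> 'b"
  assumes "\<phi> \<in> topspace X \<rightarrow> topspace Y"
  shows "continuous_map X Y \<phi> \<longleftrightarrow>
    adjoint_pair (Closed X) (Closed Y) (T_image Y \<phi>) (T_preimage X \<phi>)"
proof
  assume "continuous_map X Y \<phi>"
  then have "preimage_closure X \<phi> V = {x \<in> topspace X. \<phi> x \<in> V}" if "closedin Y V" for V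
    using that unfolding preimage_closure_def
    by (intro closure_of_closedin closedin_continuous_map_preimage)
  then show "adjoint_pair (Closed X) (Closed Y) (T_image Y \<phi>) (T_preimage X \<phi>)"
    unfolding adjoint_pair_iff_galois using image_closure_subset_iff[OF assms] by simp
next
  assume adj: "adjoint_pair (Closed X) (Closed Y) (T_image Y \<phi>) (T_preimage X \<phi>)"
  have "closedin X {x \<in> topspace X. \<phi> x \<in> V}" if V: "closedin Y V" for V
  proof -
    have cl: "closedin X (preimage_closure X \<phi> V)"
      by (simp add: preimage_closure_def)
    \<comment> \<open>the counit of the adjunction at \<open>V\<close>\<close>
    have "image_closure Y \<phi> (preimage_closure X \<phi> V) \<subseteq> V"
      using adj cl V unfolding adjoint_pair_iff_galois by blast
    then have "preimage_closure X \<phi> V \<subseteq> {x \<in> topspace X. \<phi> x \<in> V}"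
      using image_closure_subset_iff[OF assms cl V] by simp
    then show ?thesis
      unfolding preimage_closure_def by (intro closure_of_subset_eq[THEN iffD1] conjI) auto
  qed
  then show "continuous_map X Y \<phi>"
    using assms by (simp add: continuous_map_closedin Pi_iff)
qed

end
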